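(* Let $\mathbb{F}$ be a field, let $p,q,m\ge 1$ be integers, and let $A_1,\ldots,A_m\in M_{p,q}(\mathbb{F})$ be linearly independent over $\mathbb{F}$. If the bilinear system defined by $A_1,\ldots,A_m$ satisfies the $3$-corner property, or is equivalent to a bilinear system that satisfies the $3$-corner property, then the bilinear system defined by $A_1,\ldots,A_m$ is always solvable.
   Context: $M_{p,q}(\mathbb{F})$ denotes the $p$-by-$q$ matrices over $\mathbb{F}$. The bilinear system defined by $A_1,\ldots,A_m$ with right hand side $g=(g_1,\ldots,g_m)^T\in\mathbb{F}^m$ is the system $y^TA_ix=g_i$, $i=1,\ldots,m$, in the unknowns $x\in\mathbb{F}^q$, $y\in\mathbb{F}^p$. It is called always solvable if for every $g\in\mathbb{F}^m$ there exist $x\in\mathbb{F}^q$ and $y\in\mathbb{F}^p$ satisfying all $m$ equations simultaneously. The collective support of $A_1,\ldots,A_m$ is the $p$-by-$q$ pattern $\mathcal{P}$ whose $(j,k)$ position is nonzero if and only if the $(j,k)$ entry of at least one $A_i$ is nonzero. The bilinear system satisfies the $3$-corner property if $\mathcal{P}$ has no $2$-by-$2$ subpattern (the positions in two distinct rows and two distinct columns, not necessarily contiguous) in which at least $3$ of the $4$ entries are nonzero. The bilinear system defined by $A_1,\ldots,A_m$ is equivalent to the one defined by $B_1,\ldots,B_m$ if there are nonsingular matrices $P\in M_p(\mathbb{F})$ and $Q\in M_q(\mathbb{F})$ with $B_i=PA_iQ$ for $i=1,\ldots,m$. *)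

theory Defs
  imports "HOL-Analysis.Cartesian_Space"
begin

definition mat_scale :: "'a::field \<Rightarrow> 'a^'q::finite^'p::finite \<Rightarrow> 'a^'q^'p" where
  "mat_scale c = map_matrix (\<lambda>a. c * a)"

global_interpretation matvs: vector_space "mat_scale :: 'a::field \<Rightarrow> 'a^'q^'p \<Rightarrow> 'a^'q^'p"
  by unfold_locales (simp_all add: mat_scale_def vec_eq_iff algebra_simps)

text \<open>Independence of a family, not of its range: repeated members make a family dependent,
  hence the injectivity requirement.\<close>

definition lin_indep_family :: "('m::finite \<Rightarrow> 'a::field^'q^'p) \<Rightarrow> bool" where
  "lin_indep_family A \<longleftrightarrow> inj A \<and> matvs.independent (range A)"

lemma lin_indep_family_iff:
  fixes A :: "'m::finite \<Rightarrow> 'a::field^'q^'p"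
  shows "lin_indep_family A \<longleftrightarrow>
    (\<forall>c. (\<Sum>i\<in>UNIV. mat_scale (c i) (A i)) = 0 \<longrightarrow> (\<forall>i. c i = 0))"
proof
  assume ind: "lin_indep_family A"
  show "\<forall>c. (\<Sum>i\<in>UNIV. mat_scale (c i) (A i)) = 0 \<longrightarrow> (\<forall>i. c i = 0)"
  proof (intro allI impI)
    fix c i
    assume 0: "(\<Sum>i\<in>UNIV. mat_scale (c i) (A i)) = 0"
    have inj: "inj A" and "matvs.independent (range A)"
      using ind by (auto simp: lin_indep_family_def)
    moreover have "(\<Sum>v\<in>range A. mat_scale (c (inv A v)) v) = 0"
      using 0 inj by (simp add: sum.reindex)
    ultimately have "c (inv A (A i)) = 0"
      using matvs.dependent_finite[of "range A"] by fastforce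
    then show "c i = 0" using inj by simp
  qed
next
  assume *: "\<forall>c. (\<Sum>i\<in>UNIV. mat_scale (c i) (A i)) = 0 \<longrightarrow> (\<forall>i. c i = 0)"
  have inj: "inj A"
  proof (rule injI, rule ccontr)
    fix i j assume ij: "A i = A j" "i \<noteq> j"
    define c :: "'m \<Rightarrow> 'a" where "c k = (if k = i then 1 else if k = j then - 1 else 0)" for k
    have "(\<Sum>k\<in>UNIV. mat_scale (c k) (A k)) = (\<Sum>k\<in>{i,j}. mat_scale (c k) (A k))"
      by (rule sum.mono_neutral_right) (auto simp: c_def)
    also have "\<dots> = 0" using ij by (simp add: c_def)
    finally have "c i = 0" using * by blast
    then show False by (simp add: c_def)
  qed
  have "matvs.independent (range A)"
  proof
    assume "matvs.dependent (range A)"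
    then obtain u v where u: "v \<in> range A" "u v \<noteq> 0" "(\<Sum>v\<in>range A. mat_scale (u v) v) = 0"
      using matvs.dependent_finite[of "range A"] by auto
    then have "(\<Sum>i\<in>UNIV. mat_scale (u (A i)) (A i)) = 0"
      using inj by (simp add: sum.reindex)
    then show False using u *[rule_format, of "\<lambda>i. u (A i)"] by auto
  qed
  with inj show "lin_indep_family A" by (simp add: lin_indep_family_def)
qed

definition bilinear_value :: "'a::field^'p \<Rightarrow> 'a^'q^'p \<Rightarrow> 'a^'q \<Rightarrow> 'a" where
  "bilinear_value y A x = scalar_product y (A *v x)"

definition always_solvable :: "('m::finite \<Rightarrow> 'a::field^'q^'p) \<Rightarrow> bool" where
  "always_solvable A \<longleftrightarrow> (\<forall>g::'a^'m. \<exists>x y. \<forall>i. bilinear_value y (A i) x = g $ i)"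

definition collective_support :: "('m::finite \<Rightarrow> 'a::field^'q^'p) \<Rightarrow> ('p \<times> 'q) set" where
  "collective_support A = {(j, k). \<exists>i. A i $ j $ k \<noteq> 0}"

definition three_corner :: "('m::finite \<Rightarrow> 'a::field^'q^'p) \<Rightarrow> bool" where
  "three_corner A \<longleftrightarrow>
    \<not> (\<exists>j j' k k'. j \<noteq> j' \<and> k \<noteq> k' \<and>
        card (collective_support A \<inter> {j, j'} \<times> {k, k'}) \<ge> 3)"

definition equivalent_system ::
    "('m::finite \<Rightarrow> 'a::field^'q^'p) \<Rightarrow> ('m \<Rightarrow> 'a^'q^'p) \<Rightarrow> bool" where
  "equivalent_system A B \<longleftrightarrow>
    (\<exists>(P::'a^'p^'p) (Q::'a^'q^'q). invertible P \<and> invertible Q \<and> (\<forall>i. B i = P ** A i ** Q))"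

end

theory Submission
  imports Defs
begin

text \<open>Linear independence makes the map \<open>Z \<mapsto> (\<Sum>j k. A\<^sub>i\<^sub>j\<^sub>k Z\<^sub>j\<^sub>k)\<^sub>i\<close> surjective, so it remains to
  find \<open>x\<close>, \<open>y\<close> with \<open>y\<^sub>j x\<^sub>k = Z\<^sub>j\<^sub>k\<close> on the collective support. By the 3-corner property every
  support entry is alone in its row or alone in its column, so the bipartite graph of the support
  is a disjoint union of stars: put 1 at the centre of each star and the values of \<open>Z\<close> at its
  leaves.\<close>

lemma bilinear_value_sum:
  "bilinear_value y A x = (\<Sum>j\<in>UNIV. \<Sum>k\<in>UNIV. A $ j $ k * (y $ j * x $ k))"
  by (simp add: bilinear_value_def scalar_product_def matrix_vector_mult_def sum_distrib_left
      algebra_simps)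

text \<open>Flattening each \<open>A i\<close> into one row of a matrix \<open>M\<close> with
  columns indexed by pairs \<open>(j, k)\<close> turns independence of the family into independence
  of the rows of \<open>M\<close>. Hence \<open>M\<close> has a right inverse \<open>N\<close>, and
  \<open>N *v g\<close> is the flattened \<open>Z\<close>.\<close>

lemma lin_indep_family_surj:
  fixes A :: "'m::finite \<Rightarrow> 'a::field^'q::finite^'p::finite"
  assumes "lin_indep_family A"
  obtains Z :: "'p \<Rightarrow> 'q \<Rightarrow> 'a" where "\<And>i. (\<Sum>j\<in>UNIV. \<Sum>k\<in>UNIV. A i $ j $ k * Z j k) = g i"
proof -
  define M :: "'a^('p \<times> 'q)^'m" where "M = (\<chi> i jk. A i $ fst jk $ snd jk)"
  have "\<forall>i. c i = 0" if "(\<Sum>i\<in>UNIV. c i *s row i M) = 0" for c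
  proof -
    have "(\<Sum>i\<in>UNIV. c i * A i $ j $ k) = 0" for j k
      using arg_cong[OF that, of "\<lambda>v. v $ (j, k)"] by (simp add: M_def row_def)
    then have "(\<Sum>i\<in>UNIV. mat_scale (c i) (A i)) = 0"
      by (simp add: vec_eq_iff mat_scale_def)
    with assms show ?thesis by (simp add: lin_indep_family_iff)
  qed
  then obtain N where N: "M ** N = mat 1"
    using matrix_right_invertible_independent_rows[of M] by blast
  define z where "z = N *v (\<chi> i. g i)"
  have "M *v z = (\<chi> i. g i)"
    by (simp add: z_def matrix_vector_mul_assoc N)
  then have "(\<Sum>jk\<in>UNIV. M $ i $ jk * z $ jk) = g i" for i
    by (simp add: matrix_vector_mult_def vec_eq_iff)
  then have "(\<Sum>j\<in>UNIV. \<Sum>k\<in>UNIV. A i $ j $ k * z $ (j, k)) = g i" for i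
    by (simp add: M_def sum.cartesian_product case_prod_unfold)
  then show thesis using that[of "\<lambda>j k. z $ (j, k)"] by blast
qed

text \<open>Otherwise the corner \<open>(j, k)\<close> together with one further entry in its row
  and one in its column would fill three positions of a 2-by-2 subpattern.\<close>

lemma three_corner_alone:
  assumes "three_corner A"
    and "(j, k) \<in> collective_support A" "(j, k') \<in> collective_support A"
    and "(j', k) \<in> collective_support A"
  shows "j' = j \<or> k' = k"
proof (rule ccontr)
  assume "\<not> ?thesis"
  then have ne: "j \<noteq> j'" "k \<noteq> k'" by auto
  have "card {(j, k), (j, k'), (j', k)} = 3" using ne by simp
  moreover have "card {(j, k), (j, k'), (j', k)} \<le> card (collective_support A \<inter> {j, j'} \<times> {k, k'})"
    by (rule card_mono) (use assms in auto)
  ultimately show False using assms(1) ne unfolding three_corner_def by fastforce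
qed

lemma stars_factorization:
  fixes S :: "('p::finite \<times> 'q::finite) set" and Z :: "'p \<Rightarrow> 'q \<Rightarrow> 'a::field"
  assumes alone: "\<And>j k j' k'. (j, k) \<in> S \<Longrightarrow> (j, k') \<in> S \<Longrightarrow> (j', k) \<in> S \<Longrightarrow> j' = j \<or> k' = k"
  obtains x :: "'a^'q" and y :: "'a^'p" where "\<And>j k. (j, k) \<in> S \<Longrightarrow> y $ j * x $ k = Z j k"
proof -
  \<comment> \<open>\<open>col k\<close> marks the leaf columns. A component consisting of a single
    edge has its column as leaf and its row as centre. The default 1 in \<open>x\<close> and
    \<open>y\<close> is the value at the centres; it also fills empty columns and rows.\<close>
  define col where "col k \<longleftrightarrow> (\<exists>!j. (j, k) \<in> S)" for k
  define x :: "'a^'q" where "x = (\<chi> k. if col k then Z (THE j. (j, k) \<in> S) k else 1)"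
  define y :: "'a^'p" where
    "y = (\<chi> j. if \<exists>!k. (j, k) \<in> S \<and> \<not> col k then Z j (THE k. (j, k) \<in> S \<and> \<not> col k) else 1)"
  have "y $ j * x $ k = Z j k" if jk: "(j, k) \<in> S" for j k
  proof (cases "col k")
    case True
    then have "(THE j. (j, k) \<in> S) = j"
      using jk unfolding col_def by (intro the1_equality)
    \<comment> \<open>Row \<open>j\<close> is a centre, so \<open>y $ j\<close> must be 1: an entry
      \<open>(j, l)\<close> in a column that is not a leaf would have company both in its column
      and, through \<open>(j, k)\<close>, in its row.\<close>
    moreover have "\<not> (\<exists>!k. (j, k) \<in> S \<and> \<not> col k)"
    proof
      assume "\<exists>!k. (j, k) \<in> S \<and> \<not> col k"
      then obtain l where l: "(j, l) \<in> S" "\<not> col l" by blast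
      then obtain i where "(i, l) \<in> S" "i \<noteq> j" unfolding col_def by blast
      with l jk True show False using alone by blast
    qed
    ultimately show ?thesis using True by (simp add: x_def y_def)
  next
    case False
    then obtain i where i: "(i, k) \<in> S" "i \<noteq> j" using jk unfolding col_def by blast
    \<comment> \<open>Column \<open>k\<close> has a second entry, so \<open>(j, k)\<close> is alone
      in its row: \<open>j\<close> is a leaf of the star centred at \<open>k\<close>.\<close>
    then have uniq: "l = k" if "(j, l) \<in> S" for l using that jk alone by blast
    then have ex: "\<exists>!k. (j, k) \<in> S \<and> \<not> col k" using jk False by blast
    moreover have "(THE k. (j, k) \<in> S \<and> \<not> col k) = k"
      using ex by (rule the1_equality) (use jk False in simp)
    ultimately show ?thesis using False by (simp add: x_def y_def)
  qed
  then show thesis using that by blast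
qed

lemma three_corner_always_solvable:
  fixes A :: "'m::finite \<Rightarrow> 'a::field^'q::finite^'p::finite"
  assumes "lin_indep_family A" and tc: "three_corner A"
  shows "always_solvable A"
  unfolding always_solvable_def
proof
  fix g :: "'a^'m"
  obtain Z :: "'p \<Rightarrow> 'q \<Rightarrow> 'a"
    where Z: "\<And>i. (\<Sum>j\<in>UNIV. \<Sum>k\<in>UNIV. A i $ j $ k * Z j k) = g $ i"
    using lin_indep_family_surj[OF assms(1), of "\<lambda>i. g $ i"] by blast
  obtain x :: "'a^'q" and y :: "'a^'p"
    where xy: "\<And>j k. (j, k) \<in> collective_support A \<Longrightarrow> y $ j * x $ k = Z j k"
    by (rule stars_factorization[OF three_corner_alone[OF tc], where Z = Z]) blast+
  \<comment> \<open>Off the support the coefficient is 0, so \<open>y $ j * x $ k\<close> may differ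
    from \<open>Z j k\<close> there.\<close>
  have "A i $ j $ k * (y $ j * x $ k) = A i $ j $ k * Z j k" for i j k
    using xy[of j k] by (cases "A i $ j $ k = 0") (auto simp: collective_support_def)
  then have "bilinear_value y (A i) x = g $ i" for i
    by (simp only: bilinear_value_sum Z)
  then show "\<exists>x y. \<forall>i. bilinear_value y (A i) x = g $ i" by blast
qed

lemma mat_scale_mult: "mat_scale c (P ** A ** Q) = P ** mat_scale c A ** Q"
  by (simp add: mat_scale_def matrix_matrix_mult_def vec_eq_iff sum_distrib_left sum_distrib_right
      mult_ac)

lemma matrix_mult_sum:
  fixes f :: "'i \<Rightarrow> 'a::field^'q^'p"
  assumes "finite I"
  shows "(\<Sum>i\<in>I. P ** f i ** Q) = P ** (\<Sum>i\<in>I. f i) ** Q"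
  using assms
proof (induction I rule: finite_induct)
  case (insert i I)
  have "P ** (a + b) ** Q = P ** a ** Q + P ** b ** Q" for a b
    by (simp add: matrix_matrix_mult_def vec_eq_iff algebra_simps sum.distrib)
  then show ?case using insert by simp
qed simp

text \<open>A relation among the \<open>B i\<close> is \<open>P ** S ** Q = 0\<close>, with
  \<open>S\<close> the same combination of the \<open>A i\<close>; cancelling \<open>P\<close> and
  \<open>Q\<close> gives \<open>S = 0\<close>. This lets the 3-corner case be applied to
  \<open>B\<close>.\<close>

lemma equivalent_system_lin_indep:
  assumes "lin_indep_family A" and "equivalent_system A B"
  shows "lin_indep_family B"
  unfolding lin_indep_family_iff
proof (intro allI impI)
  fix c i
  obtain P Q where inv: "invertible P" "invertible Q" and B: "\<And>i. B i = P ** A i ** Q"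
    using assms(2) unfolding equivalent_system_def by blast
  obtain P' Q' where P': "P' ** P = mat 1" and Q': "Q ** Q' = mat 1"
    using inv unfolding invertible_def by blast
  define S where "S = (\<Sum>i\<in>UNIV. mat_scale (c i) (A i))"
  assume "(\<Sum>i\<in>UNIV. mat_scale (c i) (B i)) = 0"
  then have "P ** S ** Q = 0"
    by (simp add: B S_def mat_scale_mult matrix_mult_sum)
  then have "P' ** (P ** S ** Q) ** Q' = 0" by simp
  moreover have "P' ** (P ** S ** Q) ** Q' = (P' ** P) ** S ** (Q ** Q')"
    by (simp only: matrix_mul_assoc)
  ultimately have "S = 0" by (simp add: P' Q')
  then show "c i = 0" using assms(1) by (simp add: S_def lin_indep_family_iff)
qed

lemma bilinear_value_mult:
  "bilinear_value y (P ** A ** Q) x = bilinear_value (y v* P) A (Q *v x)"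
proof -
  have dot: "scalar_product y (P *v z) = scalar_product (y v* P) z" for z
  proof -
    have "scalar_product y (P *v z) = (\<Sum>j\<in>UNIV. \<Sum>k\<in>UNIV. y $ j * (P $ j $ k * z $ k))"
      by (simp add: scalar_product_def matrix_vector_mult_def sum_distrib_left)
    also have "\<dots> = (\<Sum>k\<in>UNIV. \<Sum>j\<in>UNIV. y $ j * (P $ j $ k * z $ k))"
      by (rule sum.swap)
    also have "\<dots> = scalar_product (y v* P) z"
      by (simp add: scalar_product_def vector_matrix_mult_def sum_distrib_left mult_ac)
    finally show ?thesis .
  qed
  show ?thesis
    by (simp add: bilinear_value_def dot flip: matrix_vector_mul_assoc)
qed

text \<open>The change of variables from \<open>x\<close> to \<open>Q *v x\<close> and from
  \<open>y\<close> to \<open>y v* P\<close> carries a solution for \<open>B\<close> to one for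
  \<open>A\<close> with the same right hand side.\<close>

lemma equivalent_system_always_solvable:
  assumes "equivalent_system A B" and "always_solvable B"
  shows "always_solvable A"
  unfolding always_solvable_def
proof
  fix g
  obtain P Q where B: "\<And>i. B i = P ** A i ** Q"
    using assms(1) unfolding equivalent_system_def by blast
  obtain x y where "\<forall>i. bilinear_value y (B i) x = g $ i"
    using assms(2) unfolding always_solvable_def by blast
  then have "\<forall>i. bilinear_value (y v* P) (A i) (Q *v x) = g $ i"
    by (simp add: B bilinear_value_mult)
  then show "\<exists>x y. \<forall>i. bilinear_value y (A i) x = g $ i" by blast
qed

theorem theorem5p3:
  fixes A :: "'m::finite \<Rightarrow> 'a::field^'q::finite^'p::finite"
  assumes "lin_indep_family A"
    and "three_corner A \<or>
      (\<exists>B :: 'm \<Rightarrow> 'a^'q^'p. equivalent_system A B \<and> three_corner B)"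
  shows "always_solvable A"
  using assms three_corner_always_solvable equivalent_system_lin_indep
    equivalent_system_always_solvable by blast

end
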